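(* Let $n,m,d\in\mathbb{N}$, $n_x=nd$, $n_y=md$, let $K\in\mathbb{R}^{m\times n}$ and $D=K\otimes I_d\in\mathbb{R}^{n_y\times n_x}$, with $D[i]^TD[i]=I_d$ for $i=1,\dots,n$ (equivalently, the columns of $K$ have unit Euclidean norm). Suppose $\tilde B\in\mathbb{R}^{m\times n}$ attains the minimum in $$\inf_{\substack{\tilde B\in\mathbb{R}^{m\times n}\\ \tilde B_{:,i}^TK_{:,i}=1\ \forall\,1\le i\le n}}\ \max_{i\ne j}|\tilde B_{:,i}^TK_{:,j}| .$$ Then the minimum of $$\inf_{\substack{B\in\mathbb{R}^{n_y\times n_x}\\ B[l]^TD[l]=I_d\ \forall\,1\le l\le n}}\ \max_{\substack{1\le i,j\le n\\ i\ne j}}\frac1d\|B[i]^TD[j]\|_2$$ is attained at $B=\tilde B\otimes I_d$.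
   Context: A matrix $A\in\mathbb{R}^{n_y\times n_x}$ with $n_x=nd$ is split into $n$ consecutive column blocks $A=(A[1],\dots,A[n])$ with $A[i]\in\mathbb{R}^{n_y\times d}$. $A_{:,i}$ denotes the $i$-th column of $A$, $\otimes$ the Kronecker product, $I_d$ the $d\times d$ identity, and $\|\cdot\|_2$ of a matrix the spectral norm. *)

theory Defs
  imports "HOL-Analysis.Analysis"
begin

(* Dimensions are finite index types. A matrix with n*d columns is indexed by the product type
   of the index types of n and d, the pair (i, a) standing for position (i - 1) * d + a, so that
   the i-th block of d consecutive columns consists of the columns (i, a) with i fixed; rows
   likewise. *)

definition kronecker ::
    "'a::times ^ 'n ^ 'm \<Rightarrow> 'a ^ 'q ^ 'p \<Rightarrow> 'a ^ ('n::finite \<times> 'q::finite) ^ ('m::finite \<times> 'p::finite)"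
  where "kronecker A B = (\<chi> r c. A $ fst r $ fst c * B $ snd r $ snd c)"

definition column_block :: "'n::finite \<Rightarrow> 'a ^ ('n::finite \<times> 'd) ^ 'r \<Rightarrow> 'a ^ 'd ^ 'r"
  where "column_block i A = (\<chi> r a. A $ r $ (i, a))"

definition spectral_norm :: "real ^ 'n ^ 'm \<Rightarrow> real"
  where "spectral_norm A = onorm ((*v) A)"

(* If there is only one index i, no pair i, j with i and j distinct exists and both maxima below
   are the fixed real Max {}: the objectives are then constant, and every feasible point is a
   minimizer. *)

definition cross_coherence :: "real ^ 'n ^ 'm \<Rightarrow> real ^ 'n ^ 'm \<Rightarrow> real"
  where "cross_coherence B K = Max {\<bar>column i B \<bullet> column j K\<bar> | i j. i \<noteq> j}"

definition block_cross_coherence ::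
    "real ^ ('n::finite \<times> 'd::finite) ^ 'r \<Rightarrow> real ^ ('n::finite \<times> 'd::finite) ^ 'r \<Rightarrow> real"
  where "block_cross_coherence B D =
    Max {1 / real CARD('d) * spectral_norm (transpose (column_block i B) ** column_block j D)
         | i j. i \<noteq> j}"

end

theory Submission
  imports Defs
begin

(* The (a, a) entry of B[i]^T D[j] involves only the entries B((k, a), (i, a)), that is, the
   m x n matrix obtained by fixing the position a inside the d x d cells of B. Compressing a
   feasible B in this way yields a feasible point of the scalar problem, and it can only decrease
   each term of the objective, because an entry of a matrix is bounded by the spectral norm.
   For B = Bt \<otimes> I the blocks are the multiples (Bt_i . K_j) I, so nothing is lost there. *)

definition cell_entry :: "'d \<Rightarrow> 'a ^ ('n::finite \<times> 'd::finite) ^ ('m::finite \<times> 'd) \<Rightarrow> 'a ^ 'n ^ 'm"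
  where "cell_entry a B = (\<chi> k i. B $ (k, a) $ (i, a))"

text \<open>The rows are summed over pairs \<open>(k, p)\<close>, and the identity factor of
  \<open>kronecker K (mat 1)\<close> keeps only the summands with \<open>p = b\<close>.\<close>

lemma column_block_kronecker_mat_nth:
  fixes B :: "real ^ ('n::finite \<times> 'd::finite) ^ ('m::finite \<times> 'd)" and K :: "real ^ 'n ^ 'm"
  shows "(transpose (column_block i B) ** column_block j (kronecker K (mat 1))) $ a $ b =
    (\<Sum>k\<in>UNIV. B $ (k, b) $ (i, a) * K $ k $ j)"
proof -
  have "(transpose (column_block i B) ** column_block j (kronecker K (mat 1))) $ a $ b =
      (\<Sum>(k, p)\<in>UNIV \<times> UNIV. B $ (k, p) $ (i, a) * (K $ k $ j * (if p = b then 1 else 0)))"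
    by (simp add: matrix_matrix_mult_def transpose_def column_block_def kronecker_def mat_def
        case_prod_unfold)
  also have "\<dots> = (\<Sum>k\<in>UNIV. \<Sum>p\<in>UNIV. B $ (k, p) $ (i, a) * (K $ k $ j * (if p = b then 1 else 0)))"
    by (simp only: sum.cartesian_product)
  also have "\<dots> = (\<Sum>k\<in>UNIV. B $ (k, b) $ (i, a) * K $ k $ j)"
    by (simp add: if_distrib[of "(*) _"] cong: if_cong)
  finally show ?thesis .
qed

lemma column_block_kronecker_mat_diag:
  fixes B :: "real ^ ('n::finite \<times> 'd::finite) ^ ('m::finite \<times> 'd)" and K :: "real ^ 'n ^ 'm"
  shows "(transpose (column_block i B) ** column_block j (kronecker K (mat 1))) $ a $ a =
    column i (cell_entry a B) \<bullet> column j K"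
  by (simp add: column_block_kronecker_mat_nth inner_vec_def column_def cell_entry_def)

text \<open>The identity factor on the left now also forces \<open>a = b\<close>. The case
  \<open>i = j\<close> gives feasibility of the claimed minimizer, the case of distinct
  \<open>i\<close> and \<open>j\<close> its objective value.\<close>

lemma column_block_kronecker_mat_kronecker_mat:
  fixes C K :: "real ^ 'n::finite ^ 'm::finite"
  shows "transpose (column_block i (kronecker C (mat 1 :: real ^ 'd ^ 'd::finite))) **
    column_block j (kronecker K (mat 1)) = mat (column i C \<bullet> column j K)"
proof -
  have "(\<Sum>k\<in>UNIV. kronecker C (mat 1) $ (k, b) $ (i, a) * K $ k $ j) =
      (mat (column i C \<bullet> column j K) :: real ^ 'd ^ 'd) $ a $ b" for a b :: 'd
    by (auto simp: kronecker_def mat_def inner_vec_def column_def)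
  then show ?thesis
    by (simp add: vec_eq_iff column_block_kronecker_mat_nth)
qed

lemma spectral_norm_mat: "spectral_norm (mat c :: real ^ 'd ^ 'd) = \<bar>c\<bar>"
proof -
  have "(*v) (mat c :: real ^ 'd ^ 'd) = (\<lambda>x. c *\<^sub>R x)"
    by (auto simp: fun_eq_iff vec_eq_iff matrix_vector_mult_def mat_def if_distrib[of "\<lambda>x. x * _"]
        cong: if_cong)
  moreover have "onorm (\<lambda>x :: real ^ 'd. c *\<^sub>R x) = \<bar>c\<bar>"
    by (simp add: onorm_scaleR bounded_linear_ident onorm_id)
  ultimately show ?thesis
    by (simp add: spectral_norm_def)
qed

lemma finite_offdiag_values: "finite {f i j | i j. i \<noteq> (j :: 'n::finite)}"
  by (rule finite_subset[of _ "(\<lambda>(i, j). f i j) ` UNIV"]) auto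

theorem theorem4:
  fixes K Bt :: "real ^ 'n ^ 'm"
    and D :: "real ^ ('n::finite \<times> 'd::finite) ^ ('m::finite \<times> 'd)"
  assumes "D = kronecker K (mat 1)"
    and "\<And>i. transpose (column_block i D) ** column_block i D = mat 1"
    and "is_arg_min (\<lambda>B. cross_coherence B K)
           (\<lambda>B. \<forall>i. column i B \<bullet> column i K = 1) Bt"
  shows "is_arg_min (\<lambda>B. block_cross_coherence B D)
           (\<lambda>B. \<forall>l. transpose (column_block l B) ** column_block l D = mat 1)
           (kronecker Bt (mat 1))"
proof -
  have feasible: "column i Bt \<bullet> column i K = 1" for i
    using assms(3) by (simp add: is_arg_min_def)
  have "block_cross_coherence (kronecker Bt (mat 1)) D \<le> block_cross_coherence B D"
    if B: "\<And>l. transpose (column_block l B) ** column_block l D = mat 1" for B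
  proof (cases "\<exists>i j :: 'n. i \<noteq> j")
    \<comment> \<open>With a single block index both sides are \<open>Max {}\<close>, hence
      equal.\<close>
    case False
    then show ?thesis
      by (simp add: block_cross_coherence_def)
  next
    case True
    \<comment> \<open>Any position inside the cells would serve; \<open>undefined\<close> merely
      names one.\<close>
    define C where "C = cell_entry undefined B"
    \<comment> \<open>This is one diagonal entry of the constraint on block \<open>i\<close> of
      \<open>B\<close>.\<close>
    have "column i C \<bullet> column i K = 1" for i
      using B[of i] by (simp add: C_def assms(1) mat_def flip: column_block_kronecker_mat_diag)
    then have le: "cross_coherence Bt K \<le> cross_coherence C K"
      using assms(3) by (auto simp: is_arg_min_def not_less)
    \<comment> \<open>A pair attaining the maximum for \<open>C\<close> is fixed: this single block
      product of \<open>B\<close> will dominate all off-diagonal ones of the candidate.\<close>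
    obtain i j where "i \<noteq> j" and C: "cross_coherence C K = \<bar>column i C \<bullet> column j K\<bar>"
      using Max_in[OF finite_offdiag_values, of "\<lambda>i j. \<bar>column i C \<bullet> column j K\<bar>"] True
      by (auto simp: cross_coherence_def)
    have Bt: "\<bar>column p Bt \<bullet> column q K\<bar> \<le> cross_coherence Bt K" if "p \<noteq> q" for p q
      unfolding cross_coherence_def using that by (intro Max_ge finite_offdiag_values) auto
    have "\<bar>column i C \<bullet> column j K\<bar>
        \<le> spectral_norm (transpose (column_block i B) ** column_block j D)"
      unfolding C_def spectral_norm_def assms(1) column_block_kronecker_mat_diag[symmetric]
      by (rule matrix_component_le_onorm)
    \<comment> \<open>Each term of \<open>Bt\<close> is at most its maximum, which is at most the
      maximum for \<open>C\<close>, and that is the term at \<open>i\<close>, \<open>j\<close> just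
      bounded by the norm.\<close>
    then have "\<bar>column p Bt \<bullet> column q K\<bar>
        \<le> spectral_norm (transpose (column_block i B) ** column_block j D)" if "p \<noteq> q" for p q
      using Bt[OF that] le C by linarith
    \<comment> \<open>The block products of the candidate are multiples of the identity, so their
      norms are the scalar terms; the positive factor \<open>1 / real CARD('d)\<close> is common to
      both sides.\<close>
    then have "x \<le> 1 / real CARD('d) * spectral_norm (transpose (column_block i B) ** column_block j D)"
      if "x \<in> {1 / real CARD('d) * spectral_norm (transpose (column_block p (kronecker Bt (mat 1)))
        ** column_block q D) | p q. p \<noteq> q}" for x
      using that
      by (auto simp: assms(1) column_block_kronecker_mat_kronecker_mat spectral_norm_mat
          intro!: divide_right_mono)
    \<comment> \<open>\<open>True\<close> supplies the nonemptiness needed to bound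
      \<open>Max\<close> from above.\<close>
    then have "block_cross_coherence (kronecker Bt (mat 1)) D
        \<le> 1 / real CARD('d) * spectral_norm (transpose (column_block i B) ** column_block j D)"
      unfolding block_cross_coherence_def using True
      by (intro Max.boundedI finite_offdiag_values) auto
    also have "\<dots> \<le> block_cross_coherence B D"
      unfolding block_cross_coherence_def using \<open>i \<noteq> j\<close>
      by (intro Max_ge finite_offdiag_values) auto
    finally show ?thesis .
  qed
  then show ?thesis
    by (auto simp: is_arg_min_def not_less assms(1) column_block_kronecker_mat_kronecker_mat
        feasible)
qed

end
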